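(* Let $g:\mathcal W_0\to\mathbb R$ be a graphon parameter that is convex and continuous with respect to the $L^1$ norm. Then $g$ is cut distance compatible, i.e. for any two graphons $W_1\preceq W_2$ we have $g(W_1)\le g(W_2)$.
   Context: $\Omega$ is a standard Borel space with an atomless probability measure $\nu$. A graphon is a symmetric measurable function $W:\Omega^2\to[0,1]$ (modulo null sets); $\mathcal W_0$ is the set of graphons. For a measure preserving bijection $\varphi:\Omega\to\Omega$ put $W^\varphi(x,y)=W(\varphi(x),\varphi(y))$. The cut norm is $\|Y\|_\square=\sup_{S,T\subset\Omega}|\int_{S\times T}Y|$ and the cut distance is $\delta_\square(U,W)=\inf_\varphi\|U-W^\varphi\|_\square$ over measure preserving bijections $\varphi$ of $\Omega$. Graphons $\Gamma_n$ converge weak* to $W$ if $\int_{S\times T}\Gamma_n\to\int_{S\times T}W$ for all measurable $S,T\subset\Omega$. The envelope $\langle W\rangle$ is the set of all graphons $U$ for which there are measure preserving bijections $\pi_1,\pi_2,\ldots$ of $\Omega$ with $W^{\pi_n}\to U$ weak*. Write $U\preceq W$ if $\langle U\rangle\subset\langle W\rangle$. A (real-valued) graphon parameter is a function $g:\mathcal W_0\to\mathbb R$ with $g(W_1)=g(W_2)$ whenever $\delta_\square(W_1,W_2)=0$. It is convex if for all $\alpha_1,\dots,\alpha_k\in[0,1]$ with $\sum_i\alpha_i=1$ and graphons $W,W_1,\dots,W_k$ with $W=\sum_i\alpha_iW_i$ we have $g(W)\le\sum_i\alpha_ig(W_i)$. *)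

theory Defs
  imports "HOL-Probability.Probability"
begin

definition standard_borel :: "'a measure \<Rightarrow> bool" where
  "standard_borel M \<longleftrightarrow>
     (\<exists>X. completely_metrizable_space X \<and> second_countable X \<and> topspace X = space M \<and>
          sets M = sigma_sets (topspace X) {U. openin X U})"

definition atomless :: "'a measure \<Rightarrow> bool" where
  "atomless M \<longleftrightarrow>
     \<not> (\<exists>A\<in>sets M. 0 < emeasure M A \<and>
          (\<forall>B\<in>sets M. B \<subseteq> A \<longrightarrow> emeasure M B = 0 \<or> emeasure M B = emeasure M A))"

text \<open>Graphons are handled through representatives: a graphon is an everywhere symmetric measurable
  kernel, and equality of graphons is rendered as almost-everywhere equality wherever it matters.\<close>

definition graphons :: "'a measure \<Rightarrow> ('a \<times> 'a \<Rightarrow> real) set" where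
  "graphons M = {W \<in> borel_measurable (M \<Otimes>\<^sub>M M).
     (\<forall>x\<in>space M. \<forall>y\<in>space M. W (x, y) = W (y, x) \<and> 0 \<le> W (x, y) \<and> W (x, y) \<le> 1)}"

text \<open>On a standard Borel space the inverse of a measurable bijection is automatically measurable,
  so this is not required separately.\<close>

definition mp_bijections :: "'a measure \<Rightarrow> ('a \<Rightarrow> 'a) set" where
  "mp_bijections M = {\<phi> \<in> measurable M M. bij_betw \<phi> (space M) (space M) \<and>
     (\<forall>A\<in>sets M. emeasure M (\<phi> -` A \<inter> space M) = emeasure M A)}"

definition relabel :: "('a \<times> 'a \<Rightarrow> real) \<Rightarrow> ('a \<Rightarrow> 'a) \<Rightarrow> 'a \<times> 'a \<Rightarrow> real" where
  "relabel W \<phi> = (\<lambda>(x, y). W (\<phi> x, \<phi> y))"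

definition cut_norm :: "'a measure \<Rightarrow> ('a \<times> 'a \<Rightarrow> real) \<Rightarrow> real" where
  "cut_norm M Y = (SUP (S, T)\<in>sets M \<times> sets M. \<bar>LINT z:S \<times> T|M \<Otimes>\<^sub>M M. Y z\<bar>)"

definition cut_distance :: "'a measure \<Rightarrow> ('a \<times> 'a \<Rightarrow> real) \<Rightarrow> ('a \<times> 'a \<Rightarrow> real) \<Rightarrow> real" where
  "cut_distance M U W = (INF \<phi>\<in>mp_bijections M. cut_norm M (\<lambda>z. U z - relabel W \<phi> z))"

definition weak_star_tendsto ::
    "'a measure \<Rightarrow> (nat \<Rightarrow> 'a \<times> 'a \<Rightarrow> real) \<Rightarrow> ('a \<times> 'a \<Rightarrow> real) \<Rightarrow> bool" where
  "weak_star_tendsto M \<Gamma> W \<longleftrightarrow> (\<forall>S\<in>sets M. \<forall>T\<in>sets M.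
     (\<lambda>n. LINT z:S \<times> T|M \<Otimes>\<^sub>M M. \<Gamma> n z) \<longlonglongrightarrow> (LINT z:S \<times> T|M \<Otimes>\<^sub>M M. W z))"

definition envelope :: "'a measure \<Rightarrow> ('a \<times> 'a \<Rightarrow> real) \<Rightarrow> ('a \<times> 'a \<Rightarrow> real) set" where
  "envelope M W = {U \<in> graphons M. \<exists>\<pi> :: nat \<Rightarrow> 'a \<Rightarrow> 'a.
     (\<forall>n. \<pi> n \<in> mp_bijections M) \<and> weak_star_tendsto M (\<lambda>n. relabel W (\<pi> n)) U}"

definition structuredness_le ::
    "'a measure \<Rightarrow> ('a \<times> 'a \<Rightarrow> real) \<Rightarrow> ('a \<times> 'a \<Rightarrow> real) \<Rightarrow> bool" where
  "structuredness_le M U W \<longleftrightarrow> envelope M U \<subseteq> envelope M W"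

text \<open>Representatives that agree almost everywhere have cut distance zero, so a graphon parameter
  does descend to almost-everywhere classes.\<close>

definition graphon_parameter :: "'a measure \<Rightarrow> (('a \<times> 'a \<Rightarrow> real) \<Rightarrow> real) \<Rightarrow> bool" where
  "graphon_parameter M g \<longleftrightarrow>
     (\<forall>W1\<in>graphons M. \<forall>W2\<in>graphons M. cut_distance M W1 W2 = 0 \<longrightarrow> g W1 = g W2)"

definition convex_parameter :: "'a measure \<Rightarrow> (('a \<times> 'a \<Rightarrow> real) \<Rightarrow> real) \<Rightarrow> bool" where
  "convex_parameter M g \<longleftrightarrow>
     (\<forall>(k::nat) (\<alpha> :: nat \<Rightarrow> real) (Ws :: nat \<Rightarrow> 'a \<times> 'a \<Rightarrow> real). \<forall>W\<in>graphons M.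
        (\<forall>i<k. 0 \<le> \<alpha> i \<and> \<alpha> i \<le> 1 \<and> Ws i \<in> graphons M) \<longrightarrow>
        (\<Sum>i<k. \<alpha> i) = 1 \<longrightarrow>
        (AE z in M \<Otimes>\<^sub>M M. W z = (\<Sum>i<k. \<alpha> i * Ws i z)) \<longrightarrow>
        g W \<le> (\<Sum>i<k. \<alpha> i * g (Ws i)))"

definition L1_norm :: "'a measure \<Rightarrow> ('a \<times> 'a \<Rightarrow> real) \<Rightarrow> real" where
  "L1_norm M Y = (\<integral>z. \<bar>Y z\<bar> \<partial>(M \<Otimes>\<^sub>M M))"

definition L1_continuous :: "'a measure \<Rightarrow> (('a \<times> 'a \<Rightarrow> real) \<Rightarrow> real) \<Rightarrow> bool" where
  "L1_continuous M g \<longleftrightarrow>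
     (\<forall>W\<in>graphons M. \<forall>\<epsilon>>0. \<exists>\<delta>>0. \<forall>U\<in>graphons M.
        L1_norm M (\<lambda>z. U z - W z) < \<delta> \<longrightarrow> \<bar>g U - g W\<bar> < \<epsilon>)"

definition cut_distance_compatible :: "'a measure \<Rightarrow> (('a \<times> 'a \<Rightarrow> real) \<Rightarrow> real) \<Rightarrow> bool" where
  "cut_distance_compatible M g \<longleftrightarrow>
     (\<forall>W1\<in>graphons M. \<forall>W2\<in>graphons M. structuredness_le M W1 W2 \<longrightarrow> g W1 \<le> g W2)"

end

theory Submission
  imports Defs
begin

text \<open>
  Since W1 lies in its own envelope, it is a weak* limit of relabelings of W2. The differences
  between these relabelings and W1 are bounded and converge weakly to 0, so by the Banach-Saks
  argument one may pick k of them that are nearly orthogonal in L2, whose average has L2 norm at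
  most sqrt (2 / k). Hence averages of relabelings of W2 converge to W1 in L1. By convexity and
  invariance, g is at most g W2 on each average, and L1 continuity carries this over to W1.
\<close>

section \<open>Weak convergence to 0 of uniformly bounded functions\<close>

lemma integrable_bounded_mult:
  fixes h f :: "'a \<Rightarrow> real"
  assumes "integrable N h" "f \<in> borel_measurable N" "\<And>x. x \<in> space N \<Longrightarrow> \<bar>f x\<bar> \<le> B"
  shows "integrable N (\<lambda>x. h x * f x)"
proof (rule Bochner_Integration.integrable_bound)
  show "integrable N (\<lambda>x. B * h x)" using assms(1) by simp
  show "(\<lambda>x. h x * f x) \<in> borel_measurable N" using assms(1,2) by auto
  have "\<bar>h x * f x\<bar> \<le> \<bar>B * h x\<bar>" if "x \<in> space N" for x
  proof -
    have "\<bar>h x\<bar> * \<bar>f x\<bar> \<le> \<bar>h x\<bar> * \<bar>B\<bar>"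
      using assms(3)[OF that] by (intro mult_left_mono) auto
    then show ?thesis by (simp add: abs_mult mult.commute)
  qed
  then show "AE x in N. norm (h x * f x) \<le> norm (B * h x)" by auto
qed

text \<open>Since every \<open>f n\<close> is bounded by 1, replacing \<open>h\<close> by
  \<open>s i\<close> changes the integral by at most the L1 distance of the two, uniformly in
  \<open>n\<close>. Both extension steps below, to integrable functions and to countable unions,
  rest on this.\<close>

lemma tendsto_integral_mult_L1_limit:
  fixes f s :: "nat \<Rightarrow> 'a \<Rightarrow> real"
  assumes f: "\<And>n. f n \<in> borel_measurable N" "\<And>n x. x \<in> space N \<Longrightarrow> \<bar>f n x\<bar> \<le> 1"
    and h: "integrable N h" and s: "\<And>i. integrable N (s i)"
    and lim: "(\<lambda>i. \<integral>x. \<bar>s i x - h x\<bar> \<partial>N) \<longlonglongrightarrow> 0"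
    and weak: "\<And>i. (\<lambda>n. \<integral>x. s i x * f n x \<partial>N) \<longlonglongrightarrow> 0"
  shows "(\<lambda>n. \<integral>x. h x * f n x \<partial>N) \<longlonglongrightarrow> 0"
proof (rule LIMSEQ_I)
  fix r :: real assume r: "0 < r"
  \<comment> \<open>The index \<open>i\<close> depends on \<open>r\<close> alone; only once it is
    fixed is \<open>n0\<close> taken from the convergence for \<open>s i\<close>.\<close>
  obtain i where i: "norm ((\<integral>x. \<bar>s i x - h x\<bar> \<partial>N) - 0) < r / 2"
    using LIMSEQ_D[OF lim, of "r / 2"] r by auto
  obtain n0 where n0: "\<And>n. n \<ge> n0 \<Longrightarrow> norm ((\<integral>x. s i x * f n x \<partial>N) - 0) < r / 2"
    using LIMSEQ_D[OF weak[of i], of "r / 2"] r by auto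
  have "norm ((\<integral>x. h x * f n x \<partial>N) - 0) < r" if n: "n \<ge> n0" for n
  proof -
    note int = integrable_bounded_mult[OF _ f(1)[of n] f(2)]
    have "(\<integral>x. s i x * f n x \<partial>N) - (\<integral>x. h x * f n x \<partial>N) = (\<integral>x. (s i x - h x) * f n x \<partial>N)"
      using int[OF s[of i]] int[OF h] by (simp add: left_diff_distrib)
    also have "norm \<dots> \<le> (\<integral>x. norm ((s i x - h x) * f n x) \<partial>N)"
      by (rule integral_norm_bound)
    also have "\<dots> \<le> (\<integral>x. \<bar>s i x - h x\<bar> \<partial>N)"
    proof (rule integral_mono)
      show "integrable N (\<lambda>x. norm ((s i x - h x) * f n x))"
        using h s by (intro integrable_norm int) auto
      show "integrable N (\<lambda>x. \<bar>s i x - h x\<bar>)" using h s by auto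
      show "norm ((s i x - h x) * f n x) \<le> \<bar>s i x - h x\<bar>" if "x \<in> space N" for x
        using f(2)[OF that] by (simp add: abs_mult mult_left_le)
    qed
    finally show ?thesis using i n0[OF n] by (simp add: abs_if split: if_splits)
  qed
  then show "\<exists>no. \<forall>n\<ge>no. norm ((\<integral>x. h x * f n x \<partial>N) - 0) < r" by blast
qed

text \<open>Linearity handles scaled indicators and sums, and L1 approximation handles limits.
  General integrable test functions matter because the averaging argument tests the sequence against
  its own members.\<close>

lemma tendsto_integral_mult_of_sets:
  fixes f :: "nat \<Rightarrow> 'a \<Rightarrow> real"
  assumes f: "\<And>n. f n \<in> borel_measurable N" "\<And>n x. x \<in> space N \<Longrightarrow> \<bar>f n x\<bar> \<le> 1"
    and sets: "\<And>A. A \<in> sets N \<Longrightarrow> (\<lambda>n. \<integral>x. indicator A x * f n x \<partial>N) \<longlonglongrightarrow> 0"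
    and h: "integrable N h"
  shows "(\<lambda>n. \<integral>x. h x * f n x \<partial>N) \<longlonglongrightarrow> 0"
  using h
proof (induction rule: integrable_induct)
  case (base A c)
  have "(\<lambda>n. c * (\<integral>x. indicator A x * f n x \<partial>N)) \<longlonglongrightarrow> 0"
    using tendsto_mult_left[OF sets[OF base(1)], of c] by simp
  then show ?case by (simp add: mult_ac flip: integral_mult_right_zero)
next
  case (add u v)
  note int = integrable_bounded_mult[OF _ f(1) f(2)]
  show ?case
    using tendsto_add[OF add(3,4)] int[OF add(1)] int[OF add(2)] by (simp add: distrib_right)
next
  case (lim h s)
  have "(\<lambda>i. \<integral>x. \<bar>s i x - h x\<bar> \<partial>N) \<longlonglongrightarrow> (\<integral>x. 0 \<partial>N)"
  proof (rule integral_dominated_convergence)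
    \<comment> \<open>The induction rule provides approximants with
      \<open>\<bar>s i x\<bar> \<le> 2 * \<bar>h x\<bar>\<close>, whence the factor 3 for the
      difference.\<close>
    show "integrable N (\<lambda>x. 3 * \<bar>h x\<bar>)" using lim by auto
    show "(\<lambda>x. \<bar>s i x - h x\<bar>) \<in> borel_measurable N" for i using lim by auto
    show "AE x in N. (\<lambda>i. \<bar>s i x - h x\<bar>) \<longlonglongrightarrow> 0"
      using lim(2) by (intro AE_I2) (simp add: LIM_zero tendsto_rabs_zero)
    have "norm \<bar>s i x - h x\<bar> \<le> 3 * \<bar>h x\<bar>" if "x \<in> space N" for i x
      using lim(3)[OF that, of i] by simp
    then show "AE x in N. norm \<bar>s i x - h x\<bar> \<le> 3 * \<bar>h x\<bar>" for i by (intro AE_I2)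
  qed simp
  then show ?case
    using tendsto_integral_mult_L1_limit[OF f lim(4,1) _ lim(5)] by simp
qed

text \<open>A Dynkin argument: the sets on which the integrals tend to 0 are closed under
  complements, where \<open>space N \<in> G\<close> supplies the minuend, and under countable
  disjoint unions. It is meant for \<open>G\<close> the measurable rectangles, the only sets that
  weak* convergence speaks of.\<close>

lemma tendsto_integral_sets_of_generator:
  fixes f :: "nat \<Rightarrow> 'a \<Rightarrow> real"
  assumes N: "finite_measure N"
    and gen: "Int_stable G" "G \<subseteq> Pow (space N)" "sets N = sigma_sets (space N) G" "space N \<in> G"
    and f: "\<And>n. f n \<in> borel_measurable N" "\<And>n x. x \<in> space N \<Longrightarrow> \<bar>f n x\<bar> \<le> 1"
    and weak: "\<And>A. A \<in> G \<Longrightarrow> (\<lambda>n. \<integral>x. indicator A x * f n x \<partial>N) \<longlonglongrightarrow> 0"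
    and A: "A \<in> sets N"
  shows "(\<lambda>n. \<integral>x. indicator A x * f n x \<partial>N) \<longlonglongrightarrow> 0"
proof -
  interpret N: finite_measure N by (rule N)
  have ind: "integrable N (indicat_real A)" if "A \<in> sets N" for A
    using that by (simp add: N.emeasure_finite less_top[symmetric])
  note int = integrable_bounded_mult[OF _ f(1) f(2)]
  have A_sigma: "A \<in> sigma_sets (space N) G" using A gen(3) by simp
  from gen(1,2) A_sigma show ?thesis
  proof (induction rule: sigma_sets_induct_disjoint)
    case (basic A) then show ?case by (rule weak)
  next
    case empty show ?case by simp
  next
    case (compl A)
    then have A: "A \<in> sets N" using gen(3) by simp
    have "(\<integral>x. indicator (space N - A) x * f n x \<partial>N) =
        (\<integral>x. indicator (space N) x * f n x \<partial>N) - (\<integral>x. indicator A x * f n x \<partial>N)" for n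
    proof -
      have "(\<integral>x. indicator (space N - A) x * f n x \<partial>N) =
          (\<integral>x. indicator (space N) x * f n x - indicator A x * f n x \<partial>N)"
        by (intro Bochner_Integration.integral_cong) (auto simp: indicator_def)
      then show ?thesis
        using int[OF ind[OF A]] int[OF ind[OF sets.top]]
        by (simp add: Bochner_Integration.integral_diff)
    qed
    then show ?case using tendsto_diff[OF weak[OF gen(4)] compl(2)] by simp
  next
    case (union A)
    have A: "A i \<in> sets N" for i using union(2) gen(3) by auto
    have disj: "A i \<inter> A j = {}" if "i \<noteq> j" for i j
      using union(1) that by (auto simp: disjoint_family_on_def)
    have sum: "indicat_real (\<Union>j<i. A j) x = (\<Sum>j<i. indicator (A j) x)" for i x
      using union(1) by (intro indicator_UN_disjoint) (auto simp: disjoint_family_on_def)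
    show ?case
    proof (rule tendsto_integral_mult_L1_limit[OF f, where s = "\<lambda>i. indicat_real (\<Union>j<i. A j)"])
      show "integrable N (indicat_real (\<Union>i. A i))" using A by (intro ind) auto
      show "integrable N (indicat_real (\<Union>j<i. A j))" for i using A by (intro ind) auto
      have "(\<lambda>i. \<integral>x. \<bar>indicat_real (\<Union>j<i. A j) x - indicator (\<Union>i. A i) x\<bar> \<partial>N) \<longlonglongrightarrow> (\<integral>x. 0 \<partial>N)"
      proof (rule integral_dominated_convergence)
        show "integrable N (\<lambda>x. 1::real)" by simp
        show "AE x in N. (\<lambda>i. \<bar>indicat_real (\<Union>j<i. A j) x - indicator (\<Union>i. A i) x\<bar>) \<longlonglongrightarrow> 0"
          by (intro AE_I2 tendsto_rabs_zero LIM_zero LIMSEQ_indicator_UN)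
        show "AE x in N. norm \<bar>indicat_real (\<Union>j<i. A j) x - indicator (\<Union>i. A i) x\<bar> \<le> 1" for i
          by (intro AE_I2) (auto simp: indicator_def)
      qed (use A in measurable)
      then show "(\<lambda>i. \<integral>x. \<bar>indicat_real (\<Union>j<i. A j) x - indicator (\<Union>i. A i) x\<bar> \<partial>N) \<longlonglongrightarrow> 0"
        by simp
      show "(\<lambda>n. \<integral>x. indicator (\<Union>j<i. A j) x * f n x \<partial>N) \<longlonglongrightarrow> 0" for i
      proof -
        have "(\<lambda>n. \<Sum>j<i. \<integral>x. indicator (A j) x * f n x \<partial>N) \<longlonglongrightarrow> 0"
          using union(3) by (intro tendsto_null_sum) auto
        moreover have "(\<integral>x. indicator (\<Union>j<i. A j) x * f n x \<partial>N) =
            (\<Sum>j<i. \<integral>x. indicator (A j) x * f n x \<partial>N)" for n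
          unfolding sum sum_distrib_right
          by (rule Bochner_Integration.integral_sum) (rule int[OF ind[OF A]])
        ultimately show ?thesis by simp
      qed
    qed
  qed
qed

section \<open>Banach-Saks averaging\<close>

text \<open>Indices are chosen greedily: a new one has to be good only against the finitely many
  chosen before, and each of these conditions holds eventually. No uniformity of the convergence in
  \<open>m\<close> is required.\<close>

lemma exists_nearly_orthogonal:
  fixes p :: "nat \<Rightarrow> nat \<Rightarrow> real"
  assumes "\<And>m. p m \<longlonglongrightarrow> 0" and "0 < \<epsilon>"
  shows "\<exists>r :: nat \<Rightarrow> nat. \<forall>i j. i < j \<longrightarrow> j < k \<longrightarrow> \<bar>p (r i) (r j)\<bar> < \<epsilon>"
proof (induction k)
  case 0 show ?case by simp
next
  case (Suc k)
  then obtain r :: "nat \<Rightarrow> nat" where r: "\<And>i j. i < j \<Longrightarrow> j < k \<Longrightarrow> \<bar>p (r i) (r j)\<bar> < \<epsilon>" by blast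
  have "\<forall>i\<in>{..<k}. \<forall>\<^sub>F n in sequentially. \<bar>p (r i) n\<bar> < \<epsilon>"
  proof
    fix i
    show "\<forall>\<^sub>F n in sequentially. \<bar>p (r i) n\<bar> < \<epsilon>"
      using tendstoD[OF assms(1)[of "r i"] assms(2)] by (simp add: dist_real_def)
  qed
  then have "\<forall>\<^sub>F n in sequentially. \<forall>i\<in>{..<k}. \<bar>p (r i) n\<bar> < \<epsilon>"
    by (intro eventually_ball_finite) auto
  then obtain n where n: "\<And>i. i < k \<Longrightarrow> \<bar>p (r i) n\<bar> < \<epsilon>"
    by (auto simp: eventually_sequentially)
  have "\<bar>p ((r(k := n)) i) ((r(k := n)) j)\<bar> < \<epsilon>" if "i < j" "j < Suc k" for i j
    using that r[of i j] n[of i] by (auto simp: less_Suc_eq)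
  then show ?case by blast
qed

text \<open>With pairwise inner products below \<open>1 / real k\<close>, expanding the square of
  the average bounds its integral by \<open>2 / real k\<close>; on a probability space the L2 norm
  dominates the L1 norm.\<close>

lemma banach_saks_average:
  fixes f :: "nat \<Rightarrow> 'a \<Rightarrow> real"
  assumes N: "prob_space N"
    and f: "\<And>n. f n \<in> borel_measurable N" "\<And>n x. x \<in> space N \<Longrightarrow> \<bar>f n x\<bar> \<le> 1"
    and weak: "\<And>h. integrable N h \<Longrightarrow> (\<lambda>n. \<integral>x. h x * f n x \<partial>N) \<longlonglongrightarrow> 0"
    and k: "0 < k"
  shows "\<exists>r. (\<integral>x. \<bar>\<Sum>i<k. f (r i) x / real k\<bar> \<partial>N) \<le> sqrt (2 / real k)"
proof -
  interpret N: prob_space N by (rule N)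
  have fint: "integrable N (f n)" for n
    using f by (intro N.integrable_const_bound[where B = 1]) auto
  have ffint: "integrable N (\<lambda>x. f m x * f n x)" for m n
    by (rule integrable_bounded_mult[OF fint f])
  define p where "p m n = (\<integral>x. f m x * f n x \<partial>N)" for m n
  have p_commute: "p m n = p n m" for m n by (simp add: p_def mult.commute)
  obtain r where r: "\<And>i j. i < j \<Longrightarrow> j < k \<Longrightarrow> \<bar>p (r i) (r j)\<bar> < 1 / real k"
    using exists_nearly_orthogonal[of p "1 / real k" k] weak[OF fint] k
    by (auto simp: p_def[abs_def])
  \<comment> \<open>The slack \<open>1 / real k\<close> is granted on the diagonal too, so that the
    double sum is simply k + k * k * (1 / k) = 2 * k.\<close>
  have p_le: "p (r i) (r j) \<le> (if i = j then 1 else 0) + 1 / real k" if "i < k" "j < k" for i j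
  proof (cases "i = j")
    case True
    have "p (r i) (r i) \<le> (\<integral>x. 1 \<partial>N)" unfolding p_def
      using f(2) by (intro integral_mono ffint) (auto simp: power2_eq_square[symmetric] abs_square_le_1)
    then show ?thesis using True by (simp add: N.prob_space add_increasing2)
  next
    case False
    \<comment> \<open>The choice of \<open>r\<close> controls only pairs with \<open>i < j\<close>;
      symmetry of \<open>p\<close> covers the others.\<close>
    then have "\<bar>p (r i) (r j)\<bar> < 1 / real k"
      using r[of i j] r[of j i] that p_commute by (cases "i < j") auto
    then show ?thesis using False by simp
  qed
  define F where "F x = (\<Sum>i<k. f (r i) x / real k)" for x
  have F_sq: "(F x)\<^sup>2 = (\<Sum>i<k. \<Sum>j<k. f (r i) x * f (r j) x / (real k)\<^sup>2)" for x
    unfolding F_def power2_eq_square sum_product by simp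
  have Fint: "integrable N F" unfolding F_def using fint by auto
  have F2int: "integrable N (\<lambda>x. (F x)\<^sup>2)" unfolding F_sq using ffint by auto
  have "(\<integral>x. (F x)\<^sup>2 \<partial>N) = (\<Sum>i<k. \<Sum>j<k. p (r i) (r j)) / (real k)\<^sup>2"
    unfolding F_sq p_def using ffint by (simp add: sum_divide_distrib)
  also have "\<dots> \<le> (\<Sum>i<k. \<Sum>j<k. (if i = j then 1 else 0) + 1 / real k) / (real k)\<^sup>2"
    using p_le by (intro divide_right_mono sum_mono) auto
  also have "\<dots> = 2 / real k"
    using k by (simp add: sum.distrib power2_eq_square)
  finally have F2: "(\<integral>x. (F x)\<^sup>2 \<partial>N) \<le> 2 / real k" .
  \<comment> \<open>This is nonnegativity of the variance of \<open>\<bar>F x\<bar>\<close>.\<close>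
  have "(\<integral>x. \<bar>F x\<bar> \<partial>N)\<^sup>2 \<le> (\<integral>x. (F x)\<^sup>2 \<partial>N)"
    using N.variance_positive[of "\<lambda>x. \<bar>F x\<bar>"] N.variance_eq[of "\<lambda>x. \<bar>F x\<bar>"] Fint F2int by simp
  then have "(\<integral>x. \<bar>F x\<bar> \<partial>N) \<le> sqrt (2 / real k)"
    using F2 by (intro real_le_rsqrt) simp
  then show ?thesis unfolding F_def by blast
qed

section \<open>Relabelings, cut distance and envelopes\<close>

lemma relabel_in_graphons:
  assumes W: "W \<in> graphons M" and \<phi>: "\<phi> \<in> mp_bijections M"
  shows "relabel W \<phi> \<in> graphons M"
proof -
  have m: "\<phi> \<in> measurable M M" using \<phi> by (simp add: mp_bijections_def)
  have W': "W \<in> borel_measurable (M \<Otimes>\<^sub>M M)" using W by (simp add: graphons_def)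
  have "(\<lambda>z. W (\<phi> (fst z), \<phi> (snd z))) \<in> borel_measurable (M \<Otimes>\<^sub>M M)"
    using m W' by measurable
  then show ?thesis
    using W measurable_space[OF m] by (auto simp: graphons_def relabel_def case_prod_beta')
qed

lemma graphon_diff_bound:
  assumes "U \<in> graphons M" "W \<in> graphons M" "z \<in> space (M \<Otimes>\<^sub>M M)"
  shows "\<bar>U z - W z\<bar> \<le> 1"
proof -
  obtain x y where "z = (x, y)" "x \<in> space M" "y \<in> space M"
    using assms(3) by (auto simp: space_pair_measure)
  then have "0 \<le> U z" "U z \<le> 1" "0 \<le> W z" "W z \<le> 1" using assms by (auto simp: graphons_def)
  then show ?thesis by linarith
qed

text \<open>Empty \<open>S\<close> and \<open>T\<close> contribute the value 0. A real supremum is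
  known to dominate it only once the family is bounded above, here by 1.\<close>

lemma cut_norm_nonneg:
  assumes M: "prob_space M" and U: "U \<in> graphons M" and W: "W \<in> graphons M"
  shows "0 \<le> cut_norm M (\<lambda>z. U z - W z)"
proof -
  interpret M: prob_space M by (rule M)
  interpret P: pair_prob_space M M ..
  have m: "(\<lambda>z. U z - W z) \<in> borel_measurable (M \<Otimes>\<^sub>M M)"
    using U W by (auto simp: graphons_def)
  have "\<bar>LINT z:S \<times> T|M \<Otimes>\<^sub>M M. (U z - W z)\<bar> \<le> 1" if "S \<in> sets M" "T \<in> sets M" for S T
  proof -
    have "\<bar>LINT z:S \<times> T|M \<Otimes>\<^sub>M M. (U z - W z)\<bar> \<le>
        (\<integral>z. norm (indicat_real (S \<times> T) z *\<^sub>R (U z - W z)) \<partial>(M \<Otimes>\<^sub>M M))"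
      unfolding set_lebesgue_integral_def real_norm_def[symmetric] by (rule integral_norm_bound)
    also have "\<dots> \<le> (\<integral>z. 1 \<partial>(M \<Otimes>\<^sub>M M))"
    proof (rule integral_mono)
      have le: "norm (indicat_real (S \<times> T) z *\<^sub>R (U z - W z)) \<le> 1"
        if "z \<in> space (M \<Otimes>\<^sub>M M)" for z
        using graphon_diff_bound[OF U W that] by (simp add: indicator_def)
      show "norm (indicat_real (S \<times> T) z *\<^sub>R (U z - W z)) \<le> 1"
        if "z \<in> space (M \<Otimes>\<^sub>M M)" for z using le[OF that] .
      show "integrable (M \<Otimes>\<^sub>M M) (\<lambda>z. norm (indicat_real (S \<times> T) z *\<^sub>R (U z - W z)))"
        using le m that by (intro P.integrable_const_bound[where B = 1]) auto
    qed simp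
    finally show ?thesis by (simp add: P.prob_space)
  qed
  then have bdd: "bdd_above ((\<lambda>(S, T). \<bar>LINT z:S \<times> T|M \<Otimes>\<^sub>M M. (U z - W z)\<bar>) ` (sets M \<times> sets M))"
    by (intro bdd_aboveI[where M = 1]) auto
  show ?thesis
    unfolding cut_norm_def
    using cSUP_upper[OF _ bdd, of "({}, {})"] by (auto simp: set_lebesgue_integral_def)
qed

text \<open>The infimum is attained at \<phi> itself, where the difference vanishes. Through this, a
  graphon parameter takes the same value on all relabelings of a graphon.\<close>

lemma cut_distance_relabel:
  assumes M: "prob_space M" and W: "W \<in> graphons M" and \<phi>: "\<phi> \<in> mp_bijections M"
  shows "cut_distance M (relabel W \<phi>) W = 0"
proof (rule antisym)
  note nonneg = cut_norm_nonneg[OF M relabel_in_graphons[OF W \<phi>] relabel_in_graphons[OF W]]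
  have bdd: "bdd_below ((\<lambda>\<psi>. cut_norm M (\<lambda>z. relabel W \<phi> z - relabel W \<psi> z)) ` mp_bijections M)"
    using nonneg by (intro bdd_belowI[where m = 0]) auto
  \<comment> \<open>The supremum of a constant family is that constant because the index set is
    nonempty, which \<open>sets.empty_sets\<close> witnesses.\<close>
  have "cut_norm M (\<lambda>z. relabel W \<phi> z - relabel W \<phi> z) = 0"
    using sets.empty_sets[of M]
    by (auto simp: cut_norm_def set_lebesgue_integral_def case_prod_beta' image_constant_conv
        simp del: sets.empty_sets)
  then show "cut_distance M (relabel W \<phi>) W \<le> 0"
    unfolding cut_distance_def using cINF_lower[OF bdd \<phi>] by simp
  show "0 \<le> cut_distance M (relabel W \<phi>) W"
    unfolding cut_distance_def using nonneg \<phi> by (intro cINF_greatest) auto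
qed

text \<open>The constant sequence of identity maps serves. This turns an inclusion of envelopes into
  membership of the smaller graphon in the larger envelope.\<close>

lemma self_in_envelope:
  assumes "W \<in> graphons M"
  shows "W \<in> envelope M W"
proof -
  have "(\<lambda>x. x) \<in> mp_bijections M"
  proof -
    have "(\<lambda>x. x) -` A \<inter> space M = A" if "A \<in> sets M" for A
      using sets.sets_into_space[OF that] by auto
    then show ?thesis by (auto simp: mp_bijections_def bij_betw_def)
  qed
  moreover have "relabel W (\<lambda>x. x) = W" by (simp add: relabel_def)
  ultimately show ?thesis
    using assms by (auto simp: envelope_def weak_star_tendsto_def intro!: exI[of _ "\<lambda>_ x. x"])
qed

lemma graphons_average:
  fixes Ws :: "nat \<Rightarrow> 'a \<times> 'a \<Rightarrow> real"
  assumes "\<And>i. Ws i \<in> graphons M" "0 < k"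
  shows "(\<lambda>z. \<Sum>i<k. 1 / real k * Ws i z) \<in> graphons M"
proof -
  have "(\<Sum>i<k. 1 / real k * Ws i (x, y)) \<le> 1" if "x \<in> space M" "y \<in> space M" for x y
  proof -
    have "(\<Sum>i<k. 1 / real k * Ws i (x, y)) \<le> (\<Sum>i<k. 1 / real k * 1)"
      using assms that by (intro sum_mono mult_left_mono) (auto simp: graphons_def)
    then show ?thesis using assms(2) by simp
  qed
  moreover have "Ws i \<in> borel_measurable (M \<Otimes>\<^sub>M M)" for i
    using assms by (auto simp: graphons_def)
  moreover have "Ws i (x, y) = Ws i (y, x)" "0 \<le> Ws i (x, y)"
    if "x \<in> space M" "y \<in> space M" for x y i
    using assms that by (auto simp: graphons_def)
  ultimately show ?thesis
    unfolding graphons_def by (auto intro!: sum_nonneg sum.cong)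
qed

section \<open>From weak* limits to L1 approximation, and the comparison of parameters\<close>

text \<open>The differences \<open>relabel W (\<pi> n) - U\<close> are bounded by 1 and tend to 0 on
  rectangles, hence on all measurable sets, hence against integrable functions; averaging then
  applies. The bound depends on \<open>k\<close> only.\<close>

lemma envelope_average_L1:
  assumes M: "prob_space M" and W: "W \<in> graphons M" and U: "U \<in> envelope M W" and k: "0 < k"
  shows "\<exists>\<pi> :: nat \<Rightarrow> 'a \<Rightarrow> 'a. (\<forall>i. \<pi> i \<in> mp_bijections M) \<and>
    L1_norm M (\<lambda>z. (\<Sum>i<k. 1 / real k * relabel W (\<pi> i) z) - U z) \<le> sqrt (2 / real k)"
proof -
  interpret M: prob_space M by (rule M)
  interpret P: pair_prob_space M M ..
  obtain \<pi> :: "nat \<Rightarrow> 'a \<Rightarrow> 'a" where \<pi>: "\<And>n. \<pi> n \<in> mp_bijections M"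
    and lim: "weak_star_tendsto M (\<lambda>n. relabel W (\<pi> n)) U" and U': "U \<in> graphons M"
    using U by (auto simp: envelope_def)
  define f where "f n z = relabel W (\<pi> n) z - U z" for n z
  have meas: "V \<in> borel_measurable (M \<Otimes>\<^sub>M M)" if "V \<in> graphons M" for V
    using that by (simp add: graphons_def)
  note R = relabel_in_graphons[OF W \<pi>]
  have f: "f n \<in> borel_measurable (M \<Otimes>\<^sub>M M)" "z \<in> space (M \<Otimes>\<^sub>M M) \<Longrightarrow> \<bar>f n z\<bar> \<le> 1" for n z
    unfolding f_def using meas[OF R] meas[OF U'] graphon_diff_bound[OF R U'] by auto
  have gint: "integrable (M \<Otimes>\<^sub>M M) (\<lambda>z. indicat_real A z * V z)"
    if "V \<in> graphons M" "A \<in> sets (M \<Otimes>\<^sub>M M)" for V A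
  proof (rule integrable_bounded_mult[where B = 1])
    show "integrable (M \<Otimes>\<^sub>M M) (indicat_real A)"
      using that(2) by (simp add: P.emeasure_finite less_top[symmetric])
    show "V \<in> borel_measurable (M \<Otimes>\<^sub>M M)" by (rule meas[OF that(1)])
    show "\<bar>V z\<bar> \<le> 1" if "z \<in> space (M \<Otimes>\<^sub>M M)" for z
      using \<open>V \<in> graphons M\<close> that by (auto simp: space_pair_measure graphons_def)
  qed
  have rect: "(\<lambda>n. \<integral>z. indicator A z * f n z \<partial>(M \<Otimes>\<^sub>M M)) \<longlonglongrightarrow> 0"
    if "A \<in> {S \<times> T |S T. S \<in> sets M \<and> T \<in> sets M}" for A
  proof -
    from that obtain S T where A: "A = S \<times> T" "S \<in> sets M" "T \<in> sets M" by auto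
    then have "(\<lambda>n. (LINT z:A|M \<Otimes>\<^sub>M M. relabel W (\<pi> n) z) - (LINT z:A|M \<Otimes>\<^sub>M M. U z)) \<longlonglongrightarrow> 0"
      using lim by (auto simp: weak_star_tendsto_def intro: LIM_zero)
    then show ?thesis
      using gint[OF R] gint[OF U'] A
      by (simp add: set_lebesgue_integral_def f_def right_diff_distrib)
  qed
  have sets: "(\<lambda>n. \<integral>z. indicator A z * f n z \<partial>(M \<Otimes>\<^sub>M M)) \<longlonglongrightarrow> 0" if "A \<in> sets (M \<Otimes>\<^sub>M M)" for A
  proof (rule tendsto_integral_sets_of_generator[OF P.finite_measure_axioms
        Int_stable_pair_measure_generator[of M M] _ _ _ f rect that])
    show "{a \<times> b |a b. a \<in> sets M \<and> b \<in> sets M} \<subseteq> Pow (space (M \<Otimes>\<^sub>M M))"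
      using pair_measure_closed[of M M] by (simp add: space_pair_measure)
    show "sets (M \<Otimes>\<^sub>M M) =
        sigma_sets (space (M \<Otimes>\<^sub>M M)) {a \<times> b |a b. a \<in> sets M \<and> b \<in> sets M}"
      by (simp add: sets_pair_measure space_pair_measure)
    show "space (M \<Otimes>\<^sub>M M) \<in> {a \<times> b |a b. a \<in> sets M \<and> b \<in> sets M}"
      by (auto simp: space_pair_measure)
  qed
  obtain r where r:
    "(\<integral>z. \<bar>\<Sum>i<k. f (r i) z / real k\<bar> \<partial>(M \<Otimes>\<^sub>M M)) \<le> sqrt (2 / real k)"
    using banach_saks_average[OF P.prob_space_axioms f tendsto_integral_mult_of_sets[OF f sets] k]
    by auto
  \<comment> \<open>The \<open>k\<close> weights sum to 1, so \<open>U z\<close> can be distributed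
    over the summands.\<close>
  have "(\<Sum>i<k. 1 / real k * relabel W (\<pi> (r i)) z) - U z = (\<Sum>i<k. f (r i) z / real k)" for z
    using k by (simp add: f_def diff_divide_distrib sum_subtractf)
  then show ?thesis using r \<pi> by (intro exI[of _ "\<lambda>i. \<pi> (r i)"]) (simp add: L1_norm_def)
qed

theorem theorem3p17:
  fixes \<nu> :: "'a measure"
    and g :: "('a \<times> 'a \<Rightarrow> real) \<Rightarrow> real"
  assumes "prob_space \<nu>"
    and "standard_borel \<nu>"
    and "atomless \<nu>"
    and "graphon_parameter \<nu> g"
    and "convex_parameter \<nu> g"
    and "L1_continuous \<nu> g"
  shows "cut_distance_compatible \<nu> g"
  unfolding cut_distance_compatible_def
proof (intro ballI impI)
  fix U W assume U: "U \<in> graphons \<nu>" and W: "W \<in> graphons \<nu>" and "structuredness_le \<nu> U W"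
  then have env: "U \<in> envelope \<nu> W"
    using self_in_envelope by (auto simp: structuredness_le_def)
  show "g U \<le> g W"
  proof (rule field_le_epsilon)
    fix \<epsilon> :: real assume "0 < \<epsilon>"
    then obtain \<delta> where \<delta>: "0 < \<delta>"
      and cont: "\<And>V. V \<in> graphons \<nu> \<Longrightarrow> L1_norm \<nu> (\<lambda>z. V z - U z) < \<delta> \<Longrightarrow> \<bar>g V - g U\<bar> < \<epsilon>"
      using assms(6) U unfolding L1_continuous_def by blast
    \<comment> \<open>This is \<open>sqrt (2 / real k) < \<delta>\<close> solved for
      \<open>k\<close>.\<close>
    obtain k :: nat where k: "2 / \<delta>\<^sup>2 < real k" using reals_Archimedean2 by blast
    then have k0: "0 < k" using \<delta> by (cases k) (auto simp: not_less[symmetric])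
    have "sqrt (2 / real k) < \<delta>"
      using k k0 \<delta> by (intro real_less_lsqrt) (auto simp: field_simps)
    then obtain \<pi> :: "nat \<Rightarrow> 'a \<Rightarrow> 'a" where \<pi>: "\<And>i. \<pi> i \<in> mp_bijections \<nu>"
      and L1: "L1_norm \<nu> (\<lambda>z. (\<Sum>i<k. 1 / real k * relabel W (\<pi> i) z) - U z) < \<delta>"
      using envelope_average_L1[OF assms(1) W env k0] by fastforce
    define V where "V z = (\<Sum>i<k. 1 / real k * relabel W (\<pi> i) z)" for z
    note R = relabel_in_graphons[OF W \<pi>]
    have V: "V \<in> graphons \<nu>" unfolding V_def by (rule graphons_average[OF R k0])
    \<comment> \<open>Convexity with equal weights; the almost everywhere identity holds pointwise
      by definition of \<open>V\<close>.\<close>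
    have "g V \<le> (\<Sum>i<k. 1 / real k * g (relabel W (\<pi> i)))"
      using assms(5)[unfolded convex_parameter_def, rule_format, OF V,
          of k "\<lambda>_. 1 / real k" "\<lambda>i. relabel W (\<pi> i)"] R k0
      by (simp add: V_def)
    \<comment> \<open>Every relabeling is at cut distance 0 from \<open>W\<close>, so all values of
      \<open>g\<close> coincide and the weights sum to 1.\<close>
    also have "\<dots> = g W"
      using assms(4) R W cut_distance_relabel[OF assms(1) W \<pi>] k0
      by (simp add: graphon_parameter_def)
    finally show "g U \<le> g W + \<epsilon>" using cont[OF V] L1 by (simp add: V_def)
  qed
qed

end
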